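(* Let $\epsilon>0$, $\delta\in(0,1)$, $T\in\mathbb{N}$, and consider the private distributed gradient algorithm described in the context, in which at each round $t\in\{1,\dots,T\}$ every node $i\in[N]$ perturbs its local estimate $x_i(t)$ by independent Gaussian noise $n_i(t)\sim\mathcal N(0,M_t^2 I_p)$ with $M_t>0$. Let $\Delta(t)$ be the conditional $L_2$-sensitivity at round $t$. If $$\sum_{t=1}^{T}\frac{\Delta^2(t)}{M_t^2}\le \frac{\epsilon^2}{\epsilon+2\log\frac{2}{\delta}},$$ then the algorithm, viewed as the randomized mechanism mapping the database $D$ to the sequence of all messages exchanged by the nodes, $(\mathbf{y}(t))_{t\ge 1}$, is $(\epsilon,\delta)$-differentially private.
   Context: Notation: $[N]=\{1,\dots,N\}$, $\|\cdot\|$ is the Euclidean norm, and $\mathrm{Proj}_{\mathcal X}(x)=\arg\min_{y\in\mathcal X}\|x-y\|_2$. Setting. $\mathcal X\subseteq\mathbb{R}^p$ is a nonempty compact convex set. $N$ nodes communicate over a connected undirected graph on $[N]$. The weight matrix $W=[w_{ij}]\in\mathbb{R}^{N\times N}$ is doubly stochastic with nonnegative entries, and $w_{ij}=0$ unless $j=i$ or $j$ is a neighbor of $i$. A database is $D=(D_1,\dots,D_N)$, where $D_i$ is the finite collection of data points (from a universe $\mathbb D$) stored at node $i$. The local objective of node $i$ is $f_i(x)=f_i^D(x)=\sum_{d\in D_i}\ell(x;d)$ for a loss function $\ell$, assumed differentiable in $x$ on an open set containing $\mathcal X$. Two databases $D,D'$ are neighbors, $D\sim D'$, if they differ in at most one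 data point; in particular $D_i=D'_i$, hence $f_i^D=f_i^{D'}$, for all but at most one node $i$. Algorithm (step sizes $\eta_t>0$). Start with $y_i(1)=0$ for all $i\in[N]$. For $t=1,\dots,T$ (gradient stage): $$z_i(t)=\mathrm{Proj}_{\mathcal X}\Big(\sum_{j\in[N]}w_{ij}y_j(t)\Big),\quad x_i(t)=\mathrm{Proj}_{\mathcal X}\big(z_i(t)-\eta_t\nabla f_i(z_i(t))\big),\quad y_i(t+1)=x_i(t)+n_i(t),$$ where the $n_i(t)\sim\mathcal N(0,M_t^2I_p)$ are independent over $i\in[N]$ and $t\in\{1,\dots,T\}$. After that (consensus stage) no data and no noise are used: $x_i(t)=\sum_{j\in[N]}w_{ij}y_j(t)$ for $t>T$, and $y_i(t)=x_i(t-1)$ for $t>T+1$. Node $i$ broadcasts $y_i(t)$ at round $t$, and $\mathbf y(t)=[y_1(t);\dots;y_N(t)]$. The adversary observes all messages. Conditional $L_2$-sensitivity at round $t\le T$: $$\Delta(t)=\sup_{D\sim D'}\ \sup_{i\in[N]}\ \sup_{\mathbf y(1),\dots,\mathbf y(t)}\|x_i^{D}(t)-x_i^{D'}(t)\|_2,$$ where $x_i^D(t)$ and $x_i^{D'}(t)$ are the local estimates computed from the databases $D$ and $D'$ respectively, given the same messages $\mathbf y(1),\dots,\mathbf y(t)$. A randomized mechanism $\mathcal M$ is $(\epsilon,\delta)$-differentially private if $\mathbb P[\mathcal M(D)\in S]\le e^{\epsilon}\,\mathbb P[\mathcal M(D')\in S]+\delta$ for all neighboring $D\sim D'$ and all measurable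 sets $S$ of outputs. *)

theory Defs
  imports "HOL-Probability.Probability" "HOL-Library.Multiset"
begin

text \<open>
  The index type \<open>'n\<close> is the set of nodes and \<open>'d\<close> is the universe of data points. A database maps
  every node to the finite multiset of data points it stores. An element of \<open>real ^ 'p ^ 'n\<close>
  is one round of messages: component \<open>i\<close> is the vector broadcast by node \<open>i\<close>.
\<close>

type_synonym ('n, 'd) database = "'n \<Rightarrow> 'd multiset"

definition connected_graph :: "('n \<times> 'n) set \<Rightarrow> bool" where
  "connected_graph E \<longleftrightarrow> sym E \<and> irrefl E \<and> (\<forall>i j. (i, j) \<in> E\<^sup>*)"

definition doubly_stochastic :: "real ^ 'n ^ 'n \<Rightarrow> bool" where
  "doubly_stochastic W \<longleftrightarrow>
     (\<forall>i j. 0 \<le> W $ i $ j) \<and> (\<forall>i. (\<Sum>j\<in>UNIV. W $ i $ j) = 1) \<and> (\<forall>j. (\<Sum>i\<in>UNIV. W $ i $ j) = 1)"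

text \<open>
  Databases that differ in at most one data point: they agree at all nodes but one, and there one
  point may be replaced, added or removed.
\<close>

definition neighbours :: "('n, 'd) database \<Rightarrow> ('n, 'd) database \<Rightarrow> bool" where
  "neighbours D D' \<longleftrightarrow>
     (\<exists>i. (\<forall>j. j \<noteq> i \<longrightarrow> D j = D' j) \<and> size (D i - D' i) \<le> 1 \<and> size (D' i - D i) \<le> 1)"

definition gradient :: "('a::real_inner \<Rightarrow> real) \<Rightarrow> 'a \<Rightarrow> 'a" where
  "gradient f x = (THE g. GDERIV f x :> g)"

definition local_objective ::
  "('a \<Rightarrow> 'd \<Rightarrow> real) \<Rightarrow> ('n, 'd) database \<Rightarrow> 'n \<Rightarrow> 'a \<Rightarrow> real" where
  "local_objective l D i x = (\<Sum>d\<in>#D i. l x d)"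

definition weighted_average :: "real ^ 'n ^ 'n \<Rightarrow> real ^ 'p ^ 'n \<Rightarrow> 'n \<Rightarrow> real ^ 'p" where
  "weighted_average W y i = (\<Sum>j\<in>UNIV. W $ i $ j *\<^sub>R y $ j)"

text \<open>
  The estimate \<open>x\<^sub>i(t)\<close> that node \<open>i\<close> computes from the messages \<open>y = \<^bold>y(t)\<close> of round \<open>t\<close>: a projected
  gradient step from \<open>z\<^sub>i(t)\<close> if \<open>t \<le> T\<close>, plain averaging afterwards.
\<close>

definition local_estimate ::
  "(real ^ 'p) set \<Rightarrow> real ^ 'n ^ 'n \<Rightarrow> (real ^ 'p \<Rightarrow> 'd \<Rightarrow> real) \<Rightarrow> (nat \<Rightarrow> real) \<Rightarrow> nat
    \<Rightarrow> ('n, 'd) database \<Rightarrow> nat \<Rightarrow> real ^ 'p ^ 'n \<Rightarrow> 'n \<Rightarrow> real ^ 'p" where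
  "local_estimate X W l \<eta> T D t y i =
     (if t \<le> T then
        let z = closest_point X (weighted_average W y i)
        in closest_point X (z - \<eta> t *\<^sub>R gradient (local_objective l D i) z)
      else weighted_average W y i)"

text \<open>
  The messages \<open>\<^bold>y(t)\<close> for a fixed realisation \<open>n\<close> of the noise, where \<open>n i t\<close> is \<open>n\<^sub>i(t)\<close>. Rounds are
  numbered from 1; the value at 0 is a dummy.
\<close>

primrec messages ::
  "(real ^ 'p) set \<Rightarrow> real ^ 'n ^ 'n \<Rightarrow> (real ^ 'p \<Rightarrow> 'd \<Rightarrow> real) \<Rightarrow> (nat \<Rightarrow> real) \<Rightarrow> nat
    \<Rightarrow> ('n \<Rightarrow> nat \<Rightarrow> real ^ 'p) \<Rightarrow> ('n, 'd) database \<Rightarrow> nat \<Rightarrow> real ^ 'p ^ 'n" where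
  "messages X W l \<eta> T n D 0 = 0"
| "messages X W l \<eta> T n D (Suc t) =
     (if t = 0 then 0
      else (\<chi> i. local_estimate X W l \<eta> T D t (messages X W l \<eta> T n D t) i
                 + (if t \<le> T then n i t else 0)))"

text \<open>The law of the sequence \<open>(\<^bold>y(t))\<close>, \<open>t \<ge> 1\<close>, when the noise \<open>n\<close> lives on the probability space \<open>P\<close>.\<close>

definition message_mechanism ::
  "(real ^ 'p) set \<Rightarrow> real ^ 'n ^ 'n \<Rightarrow> (real ^ 'p \<Rightarrow> 'd \<Rightarrow> real) \<Rightarrow> (nat \<Rightarrow> real) \<Rightarrow> nat
    \<Rightarrow> 'w measure \<Rightarrow> ('n \<Rightarrow> nat \<Rightarrow> 'w \<Rightarrow> real ^ 'p)
    \<Rightarrow> ('n, 'd) database \<Rightarrow> (nat \<Rightarrow> real ^ 'p ^ 'n) measure" where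
  "message_mechanism X W l \<eta> T P n D =
     distr P (\<Pi>\<^sub>M t\<in>{1..}. borel)
       (\<lambda>\<omega>. \<lambda>t\<in>{1..}. messages X W l \<eta> T (\<lambda>i s. n i s \<omega>) D t)"

text \<open>
  The supremum ranges over arbitrary message histories \<open>y\<close>, of which \<open>x\<^sub>i(t)\<close> only uses \<open>y t\<close>.
  For bounded \<open>X\<close> and \<open>t \<le> T\<close> it is taken over a nonempty bounded set of reals.
\<close>

definition sensitivity ::
  "(real ^ 'p) set \<Rightarrow> real ^ 'n ^ 'n \<Rightarrow> (real ^ 'p \<Rightarrow> 'd \<Rightarrow> real) \<Rightarrow> (nat \<Rightarrow> real) \<Rightarrow> nat
    \<Rightarrow> nat \<Rightarrow> real" where
  "sensitivity X W l \<eta> T t =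
     Sup {norm (local_estimate X W l \<eta> T D t (y t) i - local_estimate X W l \<eta> T D' t (y t) i)
          | D D' i (y :: nat \<Rightarrow> real ^ 'p ^ 'n). neighbours D D'}"

text \<open>Density of the normal distribution with mean \<open>0\<close> and covariance matrix \<open>\<sigma>\<^sup>2 I\<^sub>p\<close>.\<close>

definition isotropic_normal_density :: "real \<Rightarrow> real ^ 'p \<Rightarrow> real" where
  "isotropic_normal_density \<sigma> x = (\<Prod>k\<in>UNIV. normal_density 0 \<sigma> (x $ k))"

definition differentially_private ::
  "('b \<Rightarrow> 'b \<Rightarrow> bool) \<Rightarrow> ('b \<Rightarrow> 'o measure) \<Rightarrow> real \<Rightarrow> real \<Rightarrow> bool" where
  "differentially_private adj K \<epsilon> \<delta> \<longleftrightarrow>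
     (\<forall>D D'. adj D D' \<longrightarrow> (\<forall>S\<in>sets (K D). measure (K D) S \<le> exp \<epsilon> * measure (K D') S + \<delta>))"

end

theory Submission
  imports Defs
begin

text \<open>
  If two neighbouring databases differ at a node \<open>i\<close>, the run of the algorithm on \<open>D\<close> with noise \<open>n\<close>
  coincides with the run on \<open>D'\<close> with the noise of node \<open>i\<close> at round \<open>t\<close> translated by the difference
  \<open>v\<^sub>t\<close> of the two local estimates. As \<open>v\<^sub>t\<close> depends on the noise of earlier rounds only, the translation
  changes the law of the noise by the density \<open>exp (-L)\<close>, where the privacy loss \<open>L\<close> is the sum over \<open>t\<close>
  of \<open>\<langle>n\<^sub>t, v\<^sub>t\<rangle> / M\<^sub>t\<^sup>2 + \<parallel>v\<^sub>t\<parallel>\<^sup>2 / (2 M\<^sub>t\<^sup>2)\<close>. Integrating out the rounds from the last to the first bounds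
  the expectation of \<open>exp (\<kappa> L)\<close> by \<open>exp ((\<kappa>\<^sup>2 + \<kappa>) B / 2)\<close> with \<open>B\<close> the sum of the \<open>\<Delta>\<^sup>2(t) / M\<^sub>t\<^sup>2\<close>,
  and the Chernoff bound then makes \<open>L > \<epsilon>\<close> an event of probability at most \<open>\<delta> / 2\<close>.
\<close>

section \<open>Isotropic Gaussian noise\<close>

lemma isotropic_normal_density_eq:
  fixes x :: "real ^ 'p"
  shows "isotropic_normal_density \<sigma> x =
    (1 / sqrt (2 * pi * \<sigma>\<^sup>2)) ^ CARD('p) * exp (- (norm x)\<^sup>2 / (2 * \<sigma>\<^sup>2))"
  by (simp add: isotropic_normal_density_def normal_density_def prod.distrib exp_sum[symmetric]
      norm_vec_def L2_set_def sum_nonneg sum_divide_distrib sum_negf prod_dividef power_one_over)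

lemma isotropic_normal_density_nonneg: "0 \<le> isotropic_normal_density \<sigma> x"
  by (simp add: isotropic_normal_density_eq)

lemma measurable_isotropic_normal_density [measurable]:
  "isotropic_normal_density \<sigma> \<in> borel_measurable borel"
  unfolding isotropic_normal_density_eq[abs_def] by measurable

definition noise_measure :: "real \<Rightarrow> (real ^ 'p) measure" where
  "noise_measure \<sigma> = density lborel (\<lambda>x. ennreal (isotropic_normal_density \<sigma> x))"

lemma sets_noise_measure [simp, measurable_cong]: "sets (noise_measure \<sigma>) = sets borel"
  by (simp add: noise_measure_def)

text \<open>The density is finite everywhere, whatever \<open>\<sigma>\<close> is.
  \<open>product_sigma_finite\<close> asks for this at every index, also at those where
  \<open>\<sigma>\<close> is not known to be positive.\<close>

lemma sigma_finite_noise_measure: "sigma_finite_measure (noise_measure \<sigma>)"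
  unfolding noise_measure_def by (subst sigma_finite_measure.sigma_finite_iff_density_finite[OF sigma_finite_lborel]) auto

lemma nn_integral_noise_measure:
  assumes [measurable]: "f \<in> borel_measurable borel"
  shows "(\<integral>\<^sup>+x. f x \<partial>noise_measure \<sigma>) = (\<integral>\<^sup>+x. ennreal (isotropic_normal_density \<sigma> x) * f x \<partial>lborel)"
  unfolding noise_measure_def by (subst nn_integral_density) auto

lemma nn_integral_lborel_translate:
  fixes f :: "'a::euclidean_space \<Rightarrow> ennreal"
  assumes [measurable]: "f \<in> borel_measurable borel"
  shows "(\<integral>\<^sup>+x. f (x + a) \<partial>lborel) = (\<integral>\<^sup>+x. f x \<partial>lborel)"
  by (subst (2) lborel_distr_plus[symmetric, of a], subst nn_integral_distr) (auto simp: add.commute)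

text \<open>The log-likelihood ratio at \<open>x\<close> between the noise and the noise translated by \<open>-v\<close>.\<close>

definition privacy_loss :: "real \<Rightarrow> 'a::real_inner \<Rightarrow> 'a \<Rightarrow> real" where
  "privacy_loss \<sigma> v x = inner x v / \<sigma>\<^sup>2 + (norm v)\<^sup>2 / (2 * \<sigma>\<^sup>2)"

lemma measurable_privacy_loss [measurable]:
  fixes f g :: "'b \<Rightarrow> 'a::euclidean_space"
  assumes [measurable]: "f \<in> borel_measurable N" "g \<in> borel_measurable N"
  shows "(\<lambda>x. privacy_loss \<sigma> (f x) (g x)) \<in> borel_measurable N"
  unfolding privacy_loss_def by measurable

text \<open>Expanding the squared norm of \<open>x + v\<close> yields exactly the two terms of
  \<open>privacy_loss\<close> in the exponent.\<close>

lemma isotropic_normal_density_shift: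
  "isotropic_normal_density \<sigma> x * exp (- privacy_loss \<sigma> v x) = isotropic_normal_density \<sigma> (x + v)"
  by (simp add: isotropic_normal_density_eq privacy_loss_def exp_add[symmetric] power2_norm_eq_inner
      inner_add_left inner_add_right inner_commute add_divide_distrib diff_divide_distrib)

text \<open>Completing the square: the exponential weight moves the centre of the Gaussian to
  \<open>\<kappa> *\<^sub>R v\<close> and leaves a factor that does not depend on
  \<open>x\<close>.\<close>

lemma isotropic_normal_density_tilt:
  "isotropic_normal_density \<sigma> x * exp (\<kappa> * privacy_loss \<sigma> v x) =
   exp ((\<kappa>\<^sup>2 + \<kappa>) * ((norm v)\<^sup>2 / (2 * \<sigma>\<^sup>2))) * isotropic_normal_density \<sigma> (x - \<kappa> *\<^sub>R v)"
proof -
  have "- (norm x)\<^sup>2 / (2 * \<sigma>\<^sup>2) + \<kappa> * privacy_loss \<sigma> v x =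
      (\<kappa>\<^sup>2 + \<kappa>) * ((norm v)\<^sup>2 / (2 * \<sigma>\<^sup>2)) + - (norm (x - \<kappa> *\<^sub>R v))\<^sup>2 / (2 * \<sigma>\<^sup>2)"
    unfolding privacy_loss_def power2_norm_eq_inner
    by (cases "\<sigma> = 0") (simp_all add: inner_diff_left inner_diff_right inner_commute field_simps
        power2_eq_square)
  then show ?thesis
    by (simp add: isotropic_normal_density_eq exp_add[symmetric])
qed

text \<open>The weight turns the density at \<open>x\<close> into the density at
  \<open>x + v\<close>, and Lebesgue measure is translation invariant.\<close>

lemma nn_integral_noise_shift:
  assumes [measurable]: "f \<in> borel_measurable borel"
  shows "(\<integral>\<^sup>+x. f (x + v) * ennreal (exp (- privacy_loss \<sigma> v x)) \<partial>noise_measure \<sigma>) =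
         (\<integral>\<^sup>+x. f x \<partial>noise_measure \<sigma>)"
proof -
  have "(\<integral>\<^sup>+x. f (x + v) * ennreal (exp (- privacy_loss \<sigma> v x)) \<partial>noise_measure \<sigma>) =
      (\<integral>\<^sup>+x. ennreal (isotropic_normal_density \<sigma> (x + v)) * f (x + v) \<partial>lborel)"
    by (simp add: nn_integral_noise_measure isotropic_normal_density_shift[symmetric] ennreal_mult
        isotropic_normal_density_nonneg ac_simps)
  also have "\<dots> = (\<integral>\<^sup>+x. f x \<partial>noise_measure \<sigma>)"
    by (simp add: nn_integral_noise_measure
        nn_integral_lborel_translate[where f="\<lambda>x. ennreal (isotropic_normal_density \<sigma> x) * f x"])
  finally show ?thesis .
qed

text \<open>After tilting, a translated Gaussian of total mass 1 remains. The normalisation enters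
  as a hypothesis because it can be read off from the law of the noise variables, without computing
  a Gaussian integral.\<close>

lemma nn_integral_exp_privacy_loss:
  fixes v :: "real ^ 'p"
  assumes "prob_space (noise_measure \<sigma> :: (real ^ 'p) measure)"
  shows "(\<integral>\<^sup>+x. ennreal (exp (\<kappa> * privacy_loss \<sigma> v x)) \<partial>noise_measure \<sigma>) =
         ennreal (exp ((\<kappa>\<^sup>2 + \<kappa>) * ((norm v)\<^sup>2 / (2 * \<sigma>\<^sup>2))))"
proof -
  have 1: "(\<integral>\<^sup>+x. ennreal (isotropic_normal_density \<sigma> x) \<partial>(lborel :: (real ^ 'p) measure)) = 1"
    using prob_space.emeasure_space_1[OF assms]
    by (simp add: noise_measure_def emeasure_density)
  have "(\<integral>\<^sup>+x. ennreal (exp (\<kappa> * privacy_loss \<sigma> v x)) \<partial>noise_measure \<sigma>) =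
      (\<integral>\<^sup>+x. ennreal (exp ((\<kappa>\<^sup>2 + \<kappa>) * ((norm v)\<^sup>2 / (2 * \<sigma>\<^sup>2)))) *
         ennreal (isotropic_normal_density \<sigma> (x + - \<kappa> *\<^sub>R v)) \<partial>lborel)"
    by (simp add: nn_integral_noise_measure ennreal_mult[symmetric] isotropic_normal_density_tilt
        isotropic_normal_density_nonneg)
  also have "\<dots> = ennreal (exp ((\<kappa>\<^sup>2 + \<kappa>) * ((norm v)\<^sup>2 / (2 * \<sigma>\<^sup>2))))"
    using nn_integral_lborel_translate[of "\<lambda>x. ennreal (isotropic_normal_density \<sigma> x)" "- \<kappa> *\<^sub>R v"] 1
    by (simp add: nn_integral_cmult)
  finally show ?thesis .
qed

section \<open>Causal shifts of a product of Gaussian noises\<close>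

text \<open>
  Think of the coordinates of rank \<open>t\<close> as the noise drawn at time \<open>t\<close>: the shift of a coordinate
  only depends on strictly earlier noise.
\<close>

locale causal_shift =
  fixes I :: "'c set" and rank :: "'c \<Rightarrow> nat" and \<sigma> :: "'c \<Rightarrow> real"
    and v :: "'c \<Rightarrow> ('c \<Rightarrow> real ^ 'p) \<Rightarrow> real ^ 'p"
  assumes finite_I: "finite I"
    and prob: "\<And>c. c \<in> I \<Longrightarrow> prob_space (noise_measure (\<sigma> c) :: (real ^ 'p) measure)"
    and measurable_v: "\<And>c A. c \<in> I \<Longrightarrow> v c \<in> borel_measurable (\<Pi>\<^sub>M c\<in>A. noise_measure (\<sigma> c))"
    and causal: "\<And>c c' x y. c \<in> I \<Longrightarrow> c' \<in> I \<Longrightarrow> rank c \<le> rank c' \<Longrightarrow> v c (x(c' := y)) = v c x"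
begin

abbreviation noise :: "'c set \<Rightarrow> ('c \<Rightarrow> real ^ 'p) measure" where
  "noise A \<equiv> \<Pi>\<^sub>M c\<in>A. noise_measure (\<sigma> c)"

text \<open>Parametrised by \<open>A\<close> so that the inductions below can add the coordinates of
  \<open>I\<close> one at a time; the restriction keeps the result in the product space over
  \<open>A\<close>.\<close>

definition shift :: "'c set \<Rightarrow> ('c \<Rightarrow> real ^ 'p) \<Rightarrow> 'c \<Rightarrow> real ^ 'p" where
  "shift A x = (\<lambda>c\<in>A. x c + v c x)"

definition loss :: "'c set \<Rightarrow> ('c \<Rightarrow> real ^ 'p) \<Rightarrow> real" where
  "loss A x = (\<Sum>c\<in>A. privacy_loss (\<sigma> c) (v c x) (x c))"

sublocale product_sigma_finite "\<lambda>c. noise_measure (\<sigma> c) :: (real ^ 'p) measure"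
  by (rule product_sigma_finite.intro) (rule sigma_finite_noise_measure)

lemma measurable_shift:
  assumes "A \<subseteq> I"
  shows "shift A \<in> noise A \<rightarrow>\<^sub>M noise A"
  unfolding shift_def
proof (rule measurable_restrict)
  fix c assume c: "c \<in> A"
  then have [measurable]: "v c \<in> borel_measurable (noise A)"
    using assms measurable_v by auto
  show "(\<lambda>x. x c + v c x) \<in> noise A \<rightarrow>\<^sub>M noise_measure (\<sigma> c)"
    using c by measurable
qed

lemma measurable_loss:
  assumes "A \<subseteq> I"
  shows "loss A \<in> borel_measurable (noise A)"
  unfolding loss_def
proof (rule borel_measurable_sum)
  fix c assume c: "c \<in> A"
  then have [measurable]: "v c \<in> borel_measurable (noise A)"
    using assms measurable_v by auto
  show "(\<lambda>x. privacy_loss (\<sigma> c) (v c x) (x c)) \<in> borel_measurable (noise A)"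
    using c by measurable
qed

text \<open>Setting of the induction steps: \<open>c\<close> has maximal rank, so by causality its
  value influences neither the shifts of the coordinates in \<open>A\<close> nor its own shift. The
  shift is thus triangular and the loss additive.\<close>

context
  fixes A c
  assumes AI: "insert c A \<subseteq> I" and fresh: "c \<notin> A" and latest: "\<And>c'. c' \<in> A \<Longrightarrow> rank c' \<le> rank c"
begin

lemma v_upd: "c' \<in> insert c A \<Longrightarrow> v c' (x(c := y)) = v c' x"
  using AI latest by (intro causal) auto

lemma shift_insert: "shift (insert c A) (x(c := y)) = (shift A x)(c := y + v c x)"
  using fresh v_upd by (auto simp: shift_def fun_eq_iff)

lemma loss_insert: "loss (insert c A) (x(c := y)) = loss A x + privacy_loss (\<sigma> c) (v c x) y"
proof -
  have "finite A"
    using AI finite_I finite_subset by auto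
  moreover have "(\<Sum>c'\<in>A. privacy_loss (\<sigma> c') (v c' (x(c := y))) ((x(c := y)) c')) =
      (\<Sum>c'\<in>A. privacy_loss (\<sigma> c') (v c' x) (x c'))"
    using fresh v_upd by (intro sum.cong) auto
  ultimately show ?thesis
    using fresh v_upd by (simp add: loss_def)
qed

end

text \<open>Change of variables for a triangular map: the coordinate of highest rank is integrated
  first, and for it the shift is a constant translation. Integrating it out changes the integrand,
  hence the induction over arbitrary \<open>f\<close>.\<close>

lemma nn_integral_shift:
  assumes "A \<subseteq> I" "f \<in> borel_measurable (noise A)"
  shows "(\<integral>\<^sup>+x. f (shift A x) * ennreal (exp (- loss A x)) \<partial>noise A) = (\<integral>\<^sup>+x. f x \<partial>noise A)"
proof -
  have "finite A"
    using \<open>A \<subseteq> I\<close> finite_I by (rule finite_subset)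
  then show ?thesis
    using assms
  proof (induction A arbitrary: f rule: finite_ranking_induct[where f = rank])
    case empty
    have "x = (\<lambda>_. undefined)" if "x \<in> space (noise {})" for x
      using that by (auto simp: space_PiM)
    then show ?case
      by (intro nn_integral_cong) (simp add: shift_def loss_def restrict_def)
  next
    case (insert c A)
    show ?case
    \<comment> \<open>Induction along a ranking does not provide that the new element lies outside
      \<open>A\<close>.\<close>
    proof (cases "c \<in> A")
      case True
      then show ?thesis using insert.IH insert.prems by (simp add: insert_absorb)
    next
      case False
      have AI: "A \<subseteq> I" and cI: "c \<in> I"
        using insert.prems by auto
      note [measurable] = insert.prems(2) measurable_shift[OF insert.prems(1)]
        measurable_loss[OF insert.prems(1)] measurable_shift[OF AI] measurable_loss[OF AI]
        measurable_v[OF cI]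
      have upd: "(\<lambda>y. f (x(c := y))) \<in> borel_measurable borel" if "x \<in> space (noise A)" for x
      proof -
        have "(\<lambda>y. x(c := y)) \<in> borel \<rightarrow>\<^sub>M noise (insert c A)"
          using that by (intro measurable_fun_upd[where J = A]) auto
        from measurable_compose[OF this insert.prems(2)] show ?thesis
          by (simp add: comp_def fun_upd_def)
      qed
      have "(\<integral>\<^sup>+x. f (shift (insert c A) x) * ennreal (exp (- loss (insert c A) x)) \<partial>noise (insert c A)) =
         (\<integral>\<^sup>+x. (\<integral>\<^sup>+y. f ((shift A x)(c := y + v c x)) *
            ennreal (exp (- (loss A x + privacy_loss (\<sigma> c) (v c x) y))) \<partial>noise_measure (\<sigma> c)) \<partial>noise A)"
      proof -
        have "(\<lambda>x. f (shift (insert c A) x)) \<in> borel_measurable (noise (insert c A))"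
          by (rule measurable_compose[OF measurable_shift insert.prems(2)]) (rule insert.prems)
        then have "(\<lambda>x. f (shift (insert c A) x) * ennreal (exp (- loss (insert c A) x)))
            \<in> borel_measurable (noise (insert c A))"
          by measurable
        from product_nn_integral_insert[OF insert.hyps(1) False this] show ?thesis
          by (simp only: shift_insert[OF insert.prems(1) False insert.hyps(2)]
              loss_insert[OF insert.prems(1) False insert.hyps(2)])
      qed
      \<comment> \<open>With \<open>x\<close> fixed, \<open>v c x\<close> is a constant vector, so
        the translation lemma for a single Gaussian removes it from the inner integral.\<close>
      also have "\<dots> = (\<integral>\<^sup>+x. (\<integral>\<^sup>+y. f ((shift A x)(c := y)) \<partial>noise_measure (\<sigma> c)) *
            ennreal (exp (- loss A x)) \<partial>noise A)"
      proof (rule nn_integral_cong)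
        fix x assume x: "x \<in> space (noise A)"
        then have sx: "shift A x \<in> space (noise A)"
          by (rule measurable_space[OF measurable_shift[OF AI]])
        note [measurable] = upd[OF sx]
        have "(\<integral>\<^sup>+y. f ((shift A x)(c := y + v c x)) *
            ennreal (exp (- (loss A x + privacy_loss (\<sigma> c) (v c x) y))) \<partial>noise_measure (\<sigma> c)) =
          (\<integral>\<^sup>+y. (f ((shift A x)(c := y + v c x)) * ennreal (exp (- privacy_loss (\<sigma> c) (v c x) y))) *
            ennreal (exp (- loss A x)) \<partial>noise_measure (\<sigma> c))"
          by (intro nn_integral_cong) (simp add: exp_add ennreal_mult exp_diff exp_minus divide_inverse ac_simps)
        also have "\<dots> = (\<integral>\<^sup>+y. f ((shift A x)(c := y + v c x)) *
            ennreal (exp (- privacy_loss (\<sigma> c) (v c x) y)) \<partial>noise_measure (\<sigma> c)) * ennreal (exp (- loss A x))"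
          by (rule nn_integral_multc) measurable
        also have "\<dots> = (\<integral>\<^sup>+y. f ((shift A x)(c := y)) \<partial>noise_measure (\<sigma> c)) * ennreal (exp (- loss A x))"
          using nn_integral_noise_shift[OF upd[OF sx]] by simp
        finally show "(\<integral>\<^sup>+y. f ((shift A x)(c := y + v c x)) *
            ennreal (exp (- (loss A x + privacy_loss (\<sigma> c) (v c x) y))) \<partial>noise_measure (\<sigma> c)) = \<dots>" .
      qed
      also have "\<dots> = (\<integral>\<^sup>+x. (\<integral>\<^sup>+y. f (x(c := y)) \<partial>noise_measure (\<sigma> c)) \<partial>noise A)"
      proof (rule insert.IH[OF AI])
        interpret sigma_finite_measure "noise_measure (\<sigma> c) :: (real ^ 'p) measure"
          by (rule sigma_finite_noise_measure)
        show "(\<lambda>x. \<integral>\<^sup>+y. f (x(c := y)) \<partial>noise_measure (\<sigma> c)) \<in> borel_measurable (noise A)"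
          by measurable
      qed
      also have "\<dots> = (\<integral>\<^sup>+x. f x \<partial>noise (insert c A))"
        using insert.hyps False insert.prems(2) by (simp add: product_nn_integral_insert)
      finally show ?thesis .
    qed
  qed
qed

text \<open>The losses of different coordinates are dependent through the shifts. Given the earlier
  noise, however, the exponential moment of the last one depends only on the norm of its shift; the
  uniform bound \<open>b c\<close> makes it a constant that factors out.\<close>

lemma nn_integral_exp_loss_le:
  assumes "A \<subseteq> I" and bound: "\<And>c x. c \<in> I \<Longrightarrow> norm (v c x) \<le> b c" and "0 \<le> \<kappa>"
  shows "(\<integral>\<^sup>+x. ennreal (exp (\<kappa> * loss A x)) \<partial>noise A) \<le>
    ennreal (exp ((\<kappa>\<^sup>2 + \<kappa>) / 2 * (\<Sum>c\<in>A. (b c)\<^sup>2 / (\<sigma> c)\<^sup>2)))"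
proof -
  have "finite A"
    using \<open>A \<subseteq> I\<close> finite_I by (rule finite_subset)
  then show ?thesis
    using \<open>A \<subseteq> I\<close>
  proof (induction A rule: finite_ranking_induct[where f = rank])
    case empty
    interpret prob_space "noise {}"
      by (rule prob_space_PiM) simp
    show ?case
      using emeasure_space_1 by (simp add: loss_def)
  next
    case (insert c A)
    show ?case
    proof (cases "c \<in> A")
      case True
      then show ?thesis using insert.IH insert.prems by (simp add: insert_absorb)
    next
      case False
      have AI: "A \<subseteq> I" and cI: "c \<in> I"
        using insert.prems by auto
      note [measurable] = measurable_loss[OF insert.prems] measurable_loss[OF AI] measurable_v[OF cI]
      let ?B = "(\<kappa>\<^sup>2 + \<kappa>) / 2 * ((b c)\<^sup>2 / (\<sigma> c)\<^sup>2)"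
      have "(\<integral>\<^sup>+x. ennreal (exp (\<kappa> * loss (insert c A) x)) \<partial>noise (insert c A)) =
         (\<integral>\<^sup>+x. (\<integral>\<^sup>+y. ennreal (exp (\<kappa> * loss A x)) *
            ennreal (exp (\<kappa> * privacy_loss (\<sigma> c) (v c x) y)) \<partial>noise_measure (\<sigma> c)) \<partial>noise A)"
        using insert.hyps False insert.prems
        by (subst product_nn_integral_insert)
          (auto simp: loss_insert distrib_left exp_add ennreal_mult)
      also have "\<dots> = (\<integral>\<^sup>+x. ennreal (exp (\<kappa> * loss A x)) *
            ennreal (exp ((\<kappa>\<^sup>2 + \<kappa>) * ((norm (v c x))\<^sup>2 / (2 * (\<sigma> c)\<^sup>2)))) \<partial>noise A)"
        by (intro nn_integral_cong)
          (simp add: nn_integral_cmult nn_integral_exp_privacy_loss[OF prob[OF cI]])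
      also have "\<dots> \<le> (\<integral>\<^sup>+x. ennreal (exp (\<kappa> * loss A x)) * ennreal (exp ?B) \<partial>noise A)"
      proof (intro nn_integral_mono mult_left_mono ennreal_leI)
        fix x
        have "(norm (v c x))\<^sup>2 / (\<sigma> c)\<^sup>2 \<le> (b c)\<^sup>2 / (\<sigma> c)\<^sup>2"
          by (intro divide_right_mono power_mono bound cI) auto
        then have "(\<kappa>\<^sup>2 + \<kappa>) / 2 * ((norm (v c x))\<^sup>2 / (\<sigma> c)\<^sup>2) \<le> ?B"
          using \<open>0 \<le> \<kappa>\<close> by (intro mult_left_mono) auto
        then show "exp ((\<kappa>\<^sup>2 + \<kappa>) * ((norm (v c x))\<^sup>2 / (2 * (\<sigma> c)\<^sup>2))) \<le> exp ?B"
          by (simp add: field_simps)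
      qed simp
      also have "\<dots> = (\<integral>\<^sup>+x. ennreal (exp (\<kappa> * loss A x)) \<partial>noise A) * ennreal (exp ?B)"
        by (rule nn_integral_multc) measurable
      also have "\<dots> \<le> ennreal (exp ((\<kappa>\<^sup>2 + \<kappa>) / 2 * (\<Sum>c\<in>A. (b c)\<^sup>2 / (\<sigma> c)\<^sup>2))) * ennreal (exp ?B)"
        by (intro mult_right_mono insert.IH AI) simp
      also have "\<dots> = ennreal (exp ((\<kappa>\<^sup>2 + \<kappa>) / 2 * (\<Sum>c\<in>insert c A. (b c)\<^sup>2 / (\<sigma> c)\<^sup>2)))"
        using insert.hyps False
        by (simp add: ennreal_mult[symmetric] exp_add[symmetric] algebra_simps)
      finally show ?thesis .
    qed
  qed
qed

text \<open>Points of \<open>S\<close> with loss at most \<open>\<epsilon>\<close> are charged to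
  \<open>S'\<close> by the change of variables; the others are rare by the Chernoff bound.\<close>

lemma emeasure_shift_le:
  assumes bound: "\<And>c x. c \<in> I \<Longrightarrow> norm (v c x) \<le> b c"
    and "0 < \<epsilon>" "0 < \<delta>" "\<delta> < 1"
    and budget: "(\<Sum>c\<in>I. (b c)\<^sup>2 / (\<sigma> c)\<^sup>2) \<le> \<epsilon>\<^sup>2 / (\<epsilon> + 2 * ln (2 / \<delta>))"
    and S [measurable]: "S \<in> sets (noise I)" and S' [measurable]: "S' \<in> sets (noise I)"
    and sub: "\<And>x. x \<in> S \<Longrightarrow> shift I x \<in> S'"
  shows "emeasure (noise I) S \<le> ennreal (exp \<epsilon>) * emeasure (noise I) S' + ennreal \<delta>"
proof -
  note [measurable] = measurable_shift[OF order.refl] measurable_loss[OF order.refl]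
  \<comment> \<open>In terms of \<open>a\<close> the budget reads
    \<open>\<epsilon> / (1 + a)\<close>.\<close>
  define a where "a = 2 * ln (2 / \<delta>) / \<epsilon>"
  \<comment> \<open>the Chernoff exponent that is optimal when the budget is exhausted\<close>
  define \<kappa> where "\<kappa> = 1 / 2 + a"
  have "0 < ln (2 / \<delta>)"
    using assms by simp
  then have a: "0 < a" and \<kappa>: "0 \<le> \<kappa>"
    using assms by (simp_all add: a_def \<kappa>_def)
  have "\<epsilon>\<^sup>2 / (\<epsilon> + 2 * ln (2 / \<delta>)) = \<epsilon> / (1 + a)"
    using assms \<open>0 < ln (2 / \<delta>)\<close> by (simp add: a_def field_simps power2_eq_square)
  then have "(\<kappa>\<^sup>2 + \<kappa>) / 2 * (\<Sum>c\<in>I. (b c)\<^sup>2 / (\<sigma> c)\<^sup>2) \<le> (\<kappa>\<^sup>2 + \<kappa>) / 2 * (\<epsilon> / (1 + a))"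
    using budget \<kappa> by (intro mult_left_mono) auto
  also have "\<dots> \<le> (1 + a)\<^sup>2 / 2 * (\<epsilon> / (1 + a))"
  proof (rule mult_right_mono)
    \<comment> \<open>As \<open>\<kappa> + 1 / 2 = 1 + a\<close>, the sum of \<open>\<kappa>\<close>
      and its square is the square of \<open>1 + a\<close> minus 1/4.\<close>
    show "(\<kappa>\<^sup>2 + \<kappa>) / 2 \<le> (1 + a)\<^sup>2 / 2"
      by (simp add: \<kappa>_def power2_eq_square algebra_simps)
    show "0 \<le> \<epsilon> / (1 + a)"
      using a \<open>0 < \<epsilon>\<close> by simp
  qed
  also have "\<dots> = (1 + a) * \<epsilon> / 2"
    using a by (simp add: power2_eq_square field_simps)
  also have "\<dots> = \<kappa> * \<epsilon> - a * \<epsilon> / 2"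
    by (simp add: \<kappa>_def algebra_simps)
  also have "a * \<epsilon> / 2 = ln (2 / \<delta>)"
    using \<open>0 < \<epsilon>\<close> by (simp add: a_def)
  finally have exponent: "(\<kappa>\<^sup>2 + \<kappa>) / 2 * (\<Sum>c\<in>I. (b c)\<^sup>2 / (\<sigma> c)\<^sup>2) + - \<kappa> * \<epsilon> \<le> ln (\<delta> / 2)"
    using assms by (simp add: ln_div)
  have "emeasure (noise I) S = (\<integral>\<^sup>+x. indicator S x \<partial>noise I)"
    by simp
  \<comment> \<open>On \<open>S\<close> one of the two summands is at least 1: the first if the loss
    is at most \<open>\<epsilon>\<close>, the second otherwise.\<close>
  also have "\<dots> \<le> (\<integral>\<^sup>+x. ennreal (exp \<epsilon>) * (indicator S' (shift I x) * ennreal (exp (- loss I x))) +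
      ennreal (exp (\<kappa> * loss I x)) * ennreal (exp (- \<kappa> * \<epsilon>)) \<partial>noise I)"
  proof (rule nn_integral_mono)
    fix x
    have eq: "ennreal (exp \<epsilon>) * ennreal (exp (- loss I x)) = ennreal (exp (\<epsilon> - loss I x))"
      "ennreal (exp (\<kappa> * loss I x)) * ennreal (exp (- \<kappa> * \<epsilon>)) = ennreal (exp (\<kappa> * (loss I x - \<epsilon>)))"
      by (simp_all add: ennreal_mult[symmetric] exp_add[symmetric] algebra_simps)
    show "indicator S x \<le> ennreal (exp \<epsilon>) * (indicator S' (shift I x) * ennreal (exp (- loss I x))) +
      ennreal (exp (\<kappa> * loss I x)) * ennreal (exp (- \<kappa> * \<epsilon>))"
    proof (cases "x \<in> S")
      case True
      show ?thesis
      proof (cases "loss I x \<le> \<epsilon>")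
        case True
        then have "1 \<le> ennreal (exp (\<epsilon> - loss I x))"
          by simp
        then show ?thesis
          using \<open>x \<in> S\<close> sub[of x] eq(1) by (simp add: add_increasing2)
      next
        case False
        then have "1 \<le> ennreal (exp (\<kappa> * (loss I x - \<epsilon>)))"
          using \<kappa> by simp
        then show ?thesis
          using \<open>x \<in> S\<close> eq(2) by (simp add: add_increasing)
      qed
    qed simp
  qed
  also have "\<dots> = ennreal (exp \<epsilon>) * (\<integral>\<^sup>+x. indicator S' (shift I x) * ennreal (exp (- loss I x)) \<partial>noise I) +
      (\<integral>\<^sup>+x. ennreal (exp (\<kappa> * loss I x)) \<partial>noise I) * ennreal (exp (- \<kappa> * \<epsilon>))"
    by (simp add: nn_integral_add nn_integral_cmult nn_integral_multc)
  also have "\<dots> = ennreal (exp \<epsilon>) * emeasure (noise I) S' +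
      (\<integral>\<^sup>+x. ennreal (exp (\<kappa> * loss I x)) \<partial>noise I) * ennreal (exp (- \<kappa> * \<epsilon>))"
    by (subst nn_integral_shift) auto
  also have "\<dots> \<le> ennreal (exp \<epsilon>) * emeasure (noise I) S' + ennreal (exp
      ((\<kappa>\<^sup>2 + \<kappa>) / 2 * (\<Sum>c\<in>I. (b c)\<^sup>2 / (\<sigma> c)\<^sup>2))) * ennreal (exp (- \<kappa> * \<epsilon>))"
    by (intro add_left_mono mult_right_mono nn_integral_exp_loss_le[OF order.refl bound \<kappa>]) auto
  also have "\<dots> = ennreal (exp \<epsilon>) * emeasure (noise I) S' + ennreal (exp
      ((\<kappa>\<^sup>2 + \<kappa>) / 2 * (\<Sum>c\<in>I. (b c)\<^sup>2 / (\<sigma> c)\<^sup>2) + - \<kappa> * \<epsilon>))"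
    by (simp only: ennreal_mult[symmetric] exp_add exp_ge_zero)
  also have "\<dots> \<le> ennreal (exp \<epsilon>) * emeasure (noise I) S' + ennreal \<delta>"
  proof (intro add_left_mono ennreal_leI)
    have "exp ((\<kappa>\<^sup>2 + \<kappa>) / 2 * (\<Sum>c\<in>I. (b c)\<^sup>2 / (\<sigma> c)\<^sup>2) + - \<kappa> * \<epsilon>) \<le> \<delta> / 2"
      using exponent assms by (subst ln_ge_iff[symmetric]) (auto)
    then show "exp ((\<kappa>\<^sup>2 + \<kappa>) / 2 * (\<Sum>c\<in>I. (b c)\<^sup>2 / (\<sigma> c)\<^sup>2) + - \<kappa> * \<epsilon>) \<le> \<delta>"
      using assms by simp
  qed
  finally show ?thesis .
qed

end

section \<open>Gradients and the local estimates\<close>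

lemma gradient_eq:
  assumes "GDERIV f x :> g"
  shows "gradient f x = g"
  unfolding gradient_def
proof (rule the_equality)
  show "GDERIV f x :> g" by (rule assms)
next
  fix h assume "GDERIV f x :> h"
  then have "(\<lambda>k. k \<bullet> h) = (\<lambda>k. k \<bullet> g)"
    using assms has_derivative_unique unfolding gderiv_def by blast
  then show "h = g"
    by (metis inner_commute vector_eq_rdot)
qed

text \<open>Riesz representation in coordinates: the derivative is the inner product with the vector
  of its values on the basis.\<close>

lemma differentiable_imp_GDERIV:
  fixes f :: "'a::euclidean_space \<Rightarrow> real"
  assumes "f differentiable (at x)"
  shows "GDERIV f x :> gradient f x"
proof -
  obtain f' where f': "(f has_derivative f') (at x)"
    using assms by (auto simp: differentiable_def)
  define g where "g = (\<Sum>b\<in>Basis. f' b *\<^sub>R b)"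
  interpret f': bounded_linear f'
    using f' by (rule has_derivative_bounded_linear)
  have "f' h = h \<bullet> g" for h
  proof -
    have "f' h = f' (\<Sum>b\<in>Basis. (h \<bullet> b) *\<^sub>R b)"
      by (simp add: euclidean_representation)
    also have "\<dots> = h \<bullet> g"
      by (simp add: f'.sum f'.scaleR g_def inner_sum_right mult.commute)
    finally show ?thesis .
  qed
  then have "GDERIV f x :> g"
    using f' unfolding gderiv_def by (metis ext)
  then show ?thesis
    using gradient_eq by metis
qed

text \<open>
  Outside \<open>U\<close> the function \<open>f\<close> is arbitrary, so the difference quotients are taken of its
  restriction to \<open>U\<close>, which is Borel.
\<close>

lemma measurable_gradient:
  fixes f :: "'a::euclidean_space \<Rightarrow> real"
  assumes "open U" and diff: "\<And>x. x \<in> U \<Longrightarrow> f differentiable (at x)"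
    and z [measurable]: "z \<in> borel_measurable N" and zU: "\<And>w. w \<in> space N \<Longrightarrow> z w \<in> U"
  shows "(\<lambda>w. gradient f (z w)) \<in> borel_measurable N"
proof (rule borel_measurable_euclidean_space[THEN iffD2], rule ballI)
  fix b :: 'a assume "b \<in> Basis"
  define h where "h x = indicator U x *\<^sub>R f x" for x
  have "continuous_on U f"
    by (intro continuous_at_imp_continuous_on ballI differentiable_imp_continuous_within diff)
  then have [measurable]: "h \<in> borel_measurable borel"
    unfolding h_def using \<open>open U\<close> by (intro borel_measurable_continuous_on_indicator) auto
  let ?s = "\<lambda>k. 1 / real (Suc k)"
  show "(\<lambda>w. gradient f (z w) \<bullet> b) \<in> borel_measurable N"
  proof (rule borel_measurable_LIMSEQ_real)
    fix k
    show "(\<lambda>w. (h (z w + ?s k *\<^sub>R b) - h (z w)) / ?s k) \<in> borel_measurable N"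
      by measurable
  next
    fix w assume "w \<in> space N"
    then have w: "z w \<in> U" by (rule zU)
    have s0: "?s \<longlonglongrightarrow> 0"
      using LIMSEQ_inverse_real_of_nat by (simp add: inverse_eq_divide)
    have "((\<lambda>r. f (z w + r *\<^sub>R b)) has_real_derivative gradient f (z w) \<bullet> b) (at 0)"
    proof -
      have "(f has_derivative (\<lambda>h. h \<bullet> gradient f (z w))) (at (z w + 0 *\<^sub>R b))"
        using differentiable_imp_GDERIV[OF diff[OF w]] by (simp add: gderiv_def)
      moreover have "((\<lambda>r. z w + r *\<^sub>R b) has_derivative (\<lambda>r. r *\<^sub>R b)) (at (0::real))"
        by (auto intro!: derivative_eq_intros)
      ultimately have "((\<lambda>r. f (z w + r *\<^sub>R b)) has_derivative
          (\<lambda>r. (r *\<^sub>R b) \<bullet> gradient f (z w))) (at 0)"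
        by (rule has_derivative_compose[rotated])
      then show ?thesis
        by (simp add: has_field_derivative_def inner_commute mult.commute[of _ "b \<bullet> _"] cong: if_cong)
    qed
    then have "((\<lambda>r. (f (z w + r *\<^sub>R b) - f (z w)) / r) \<longlongrightarrow> gradient f (z w) \<bullet> b) (at 0)"
      by (simp add: DERIV_def)
    moreover have "filterlim ?s (at 0) sequentially"
      using s0 by (auto simp: filterlim_at)
    ultimately have "(\<lambda>k. (f (z w + ?s k *\<^sub>R b) - f (z w)) / ?s k) \<longlonglongrightarrow> gradient f (z w) \<bullet> b"
      by (rule filterlim_compose)
    moreover have "\<forall>\<^sub>F k in sequentially. z w + ?s k *\<^sub>R b \<in> U"
    proof -
      have "(\<lambda>k. z w + ?s k *\<^sub>R b) \<longlonglongrightarrow> z w + 0 *\<^sub>R b"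
        by (intro tendsto_intros s0)
      then show ?thesis
        using \<open>open U\<close> w topological_tendstoD by fastforce
    qed
    then have "\<forall>\<^sub>F k in sequentially. (f (z w + ?s k *\<^sub>R b) - f (z w)) / ?s k =
        (h (z w + ?s k *\<^sub>R b) - h (z w)) / ?s k"
      by eventually_elim (simp add: h_def w)
    ultimately show "(\<lambda>k. (h (z w + ?s k *\<^sub>R b) - h (z w)) / ?s k) \<longlonglongrightarrow> gradient f (z w) \<bullet> b"
      by (rule Lim_transform_eventually)
  qed
qed

lemma differentiable_local_objective:
  fixes l :: "'a::real_normed_vector \<Rightarrow> 'd \<Rightarrow> real"
  assumes "\<And>d. (\<lambda>x. l x d) differentiable (at x)"
  shows "local_objective l D i differentiable (at x)"
proof -
  have "(\<lambda>x. \<Sum>d\<in>#C. l x d) differentiable (at x)" for C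
    using assms by (induction C) auto
  then show ?thesis
    unfolding local_objective_def[abs_def] .
qed

lemma continuous_weighted_average: "continuous_on UNIV (\<lambda>y. weighted_average W y i)"
  unfolding weighted_average_def by (intro continuous_intros)

text \<open>Averaging and projection onto a closed convex set are continuous. The gradient may be
  discontinuous, but it is evaluated only at points of \<open>X\<close>, hence in \<open>U\<close>,
  where it is a limit of difference quotients.\<close>

lemma measurable_local_estimate:
  fixes X U :: "(real ^ 'p) set" and W :: "real ^ 'n ^ 'n"
  assumes "X \<noteq> {}" "compact X" "convex X" "open U" "X \<subseteq> U"
    and diff: "\<And>d x. x \<in> U \<Longrightarrow> (\<lambda>x. l x d) differentiable (at x)"
  shows "(\<lambda>y. local_estimate X W l \<eta> T D t y i) \<in> borel_measurable borel"
proof -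
  have [measurable]: "(\<lambda>y. weighted_average W y i) \<in> borel_measurable borel"
    by (intro borel_measurable_continuous_onI continuous_weighted_average)
  have [measurable]: "closest_point X \<in> borel_measurable borel"
    using assms by (intro borel_measurable_continuous_onI continuous_on_closest_point compact_imp_closed)
  have [measurable]: "(\<lambda>y. gradient (local_objective l D i) (closest_point X (weighted_average W y i)))
      \<in> borel_measurable borel"
  proof (rule measurable_gradient[OF \<open>open U\<close>])
    show "local_objective l D i differentiable (at x)" if "x \<in> U" for x
      using diff[OF that] by (rule differentiable_local_objective)
    show "closest_point X (weighted_average W y i) \<in> U" for y
      using assms closest_point_in_set[of X] compact_imp_closed by blast
  qed measurable
  show ?thesis
    unfolding local_estimate_def Let_def by measurable
qed

text \<open>The real supremum is an upper bound only for a set bounded above; here both estimates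
  are projections onto the compact set \<open>X\<close>.\<close>

lemma norm_local_estimate_diff_le_sensitivity:
  fixes X :: "(real ^ 'p) set" and W :: "real ^ 'n ^ 'n" and D D' :: "('n, 'd) database"
  assumes "X \<noteq> {}" "compact X" "t \<le> T" "neighbours D D'"
  shows "norm (local_estimate X W l \<eta> T D t y i - local_estimate X W l \<eta> T D' t y i)
    \<le> sensitivity X W l \<eta> T t"
  unfolding sensitivity_def
proof (rule cSup_upper)
  have in_X: "local_estimate X W l \<eta> T D t y i \<in> X"
    for D :: "('n, 'd) database" and y i
    using assms closest_point_in_set[of X] compact_imp_closed by (auto simp: local_estimate_def Let_def)
  obtain B where "\<And>x. x \<in> X \<Longrightarrow> norm x \<le> B"
    using compact_imp_bounded[OF \<open>compact X\<close>] by (auto simp: bounded_iff)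
  then have "norm (local_estimate X W l \<eta> T D t y i - local_estimate X W l \<eta> T D' t y i) \<le> B + B"
    for D D' :: "('n, 'd) database" and y i
    using in_X norm_triangle_le_diff by (meson add_mono)
  then show "bdd_above {norm (local_estimate X W l \<eta> T D t (y t) i -
      local_estimate X W l \<eta> T D' t (y t) i) | D D' i (y :: nat \<Rightarrow> real ^ 'p ^ 'n). neighbours D D'}"
    by (intro bdd_aboveI) auto
  show "norm (local_estimate X W l \<eta> T D t y i - local_estimate X W l \<eta> T D' t y i)
    \<in> {norm (local_estimate X W l \<eta> T D t (y t) i -
      local_estimate X W l \<eta> T D' t (y t) i) | D D' i (y :: nat \<Rightarrow> real ^ 'p ^ 'n). neighbours D D'}"
    by (intro CollectI exI[of _ D] exI[of _ D'] exI[of _ i] exI[of _ "\<lambda>_. y"] conjI refl assms)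
qed

lemma local_estimate_consensus: "T < t \<Longrightarrow> local_estimate X W l \<eta> T D t y i = weighted_average W y i"
  by (simp add: local_estimate_def)

lemma local_estimate_cong: "D i = D' i \<Longrightarrow> local_estimate X W l \<eta> T D t y i = local_estimate X W l \<eta> T D' t y i"
  by (simp add: local_estimate_def local_objective_def[abs_def])

lemma measurable_vec_lambda:
  fixes f :: "'n::finite \<Rightarrow> 'b \<Rightarrow> 'a::euclidean_space"
  assumes "\<And>i. f i \<in> borel_measurable N"
  shows "(\<lambda>x. \<chi> i. f i x) \<in> borel_measurable N"
proof (rule borel_measurable_euclidean_space[THEN iffD2], rule ballI)
  fix b :: "'a ^ 'n" assume "b \<in> Basis"
  then obtain i u where "b = axis i u"
    by (auto simp: Basis_vec_def)
  then show "(\<lambda>x. (\<chi> i. f i x) \<bullet> b) \<in> borel_measurable N"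
    using assms by (simp add: inner_axis)
qed

section \<open>Messages as a function of the noise\<close>

text \<open>Causality of the algorithm: round \<open>t\<close> has seen only noise from rounds
  strictly before \<open>t\<close>, and none after \<open>T\<close>.\<close>

lemma messages_cong:
  assumes "\<And>i s. 1 \<le> s \<Longrightarrow> s \<le> T \<Longrightarrow> s < t \<Longrightarrow> n i s = n' i s"
  shows "messages X W l \<eta> T n D t = messages X W l \<eta> T n' D t"
  using assms
proof (induction t)
  case (Suc t)
  then have "messages X W l \<eta> T n D t = messages X W l \<eta> T n' D t"
    by simp
  then show ?case
    using Suc.prems by (auto intro: arg_cong[where f = vec_lambda])
qed simp

text \<open>Coupling of the two runs: while the messages agree so far, the added noise cancels the
  difference of the estimates. Round 1 is 0 for both databases, and the consensus stage does not
  look at the data.\<close>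

lemma messages_shift:
  assumes "\<And>i t. 1 \<le> t \<Longrightarrow> t \<le> T \<Longrightarrow>
    n' i t = n i t + (local_estimate X W l \<eta> T D t (messages X W l \<eta> T n D t) i
                      - local_estimate X W l \<eta> T D' t (messages X W l \<eta> T n D t) i)"
  shows "messages X W l \<eta> T n' D' t = messages X W l \<eta> T n D t"
proof (induction t)
  case (Suc t)
  then show ?case
    using assms[of t] by (cases "t \<le> T") (simp_all add: local_estimate_consensus add.commute)
qed simp

lemma measurable_messages:
  fixes X U :: "(real ^ 'p) set" and W :: "real ^ 'n ^ 'n"
  assumes "X \<noteq> {}" "compact X" "convex X" "open U" "X \<subseteq> U"
    and "\<And>d x. x \<in> U \<Longrightarrow> (\<lambda>x. l x d) differentiable (at x)"
    and n: "\<And>i s. 1 \<le> s \<Longrightarrow> s \<le> T \<Longrightarrow> n i s \<in> borel_measurable N"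
  shows "(\<lambda>\<omega>. messages X W l \<eta> T (\<lambda>i s. n i s \<omega>) D t) \<in> borel_measurable N"
proof (induction t)
  case (Suc t)
  have est: "(\<lambda>\<omega>. local_estimate X W l \<eta> T D t (messages X W l \<eta> T (\<lambda>i s. n i s \<omega>) D t) i)
      \<in> borel_measurable N" for i
    using measurable_compose[OF Suc measurable_local_estimate[OF assms(1-6)]] .
  show ?case
  proof (cases "t = 0")
    case False
    have "(\<lambda>\<omega>. if t \<le> T then n i t \<omega> else 0) \<in> borel_measurable N" for i
      using n[of t i] False by (cases "t \<le> T") auto
    with est have "(\<lambda>\<omega>. \<chi> i. local_estimate X W l \<eta> T D t (messages X W l \<eta> T (\<lambda>i s. n i s \<omega>) D t) i +
        (if t \<le> T then n i t \<omega> else 0)) \<in> borel_measurable N"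
      by (intro measurable_vec_lambda borel_measurable_add)
    then show ?thesis
      using False by simp
  qed simp
qed simp

text \<open>Coordinates outside \<open>A\<close> are constantly \<open>undefined\<close> on the product space.\<close>

lemma borel_measurable_PiM_component:
  fixes M :: "'i \<Rightarrow> 'a::topological_space measure"
  assumes "\<And>i. i \<in> A \<Longrightarrow> sets (M i) = sets borel"
  shows "(\<lambda>x. x i) \<in> borel_measurable (\<Pi>\<^sub>M i\<in>A. M i)"
proof (cases "i \<in> A")
  case True
  then show ?thesis
    using measurable_component_singleton[of i A M] assms by (simp cong: measurable_cong_sets)
next
  case False
  then have outside: "x i = undefined" if "x \<in> space (\<Pi>\<^sub>M i\<in>A. M i)" for x
    using that unfolding space_PiM by (rule PiE_arb[rotated])
  have "(\<lambda>x. x i) \<in> borel_measurable (\<Pi>\<^sub>M i\<in>A. M i) \<longleftrightarrow>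
      (\<lambda>_. undefined :: 'a) \<in> borel_measurable (\<Pi>\<^sub>M i\<in>A. M i)"
    by (rule measurable_cong[OF outside])
  then show ?thesis
    by (simp only: borel_measurable_const)
qed

section \<open>Transfer from the noise space to the law of the messages\<close>

theorem theorem1:
  fixes X U :: "(real ^ 'p) set"
    and E :: "('n::finite \<times> 'n) set"
    and W :: "real ^ 'n ^ 'n"
    and l :: "real ^ 'p \<Rightarrow> 'd \<Rightarrow> real"
    and \<eta> M :: "nat \<Rightarrow> real"
    and T :: nat
    and P :: "'w measure"
    and n :: "'n \<Rightarrow> nat \<Rightarrow> 'w \<Rightarrow> real ^ 'p"
    and \<epsilon> \<delta> :: real
  assumes "X \<noteq> {}" "compact X" "convex X"
    and "connected_graph E"
    and "doubly_stochastic W"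
    and "\<And>i j. j \<noteq> i \<Longrightarrow> (i, j) \<notin> E \<Longrightarrow> W $ i $ j = 0"
    and "open U" "X \<subseteq> U"
    and "\<And>d x. x \<in> U \<Longrightarrow> (\<lambda>x. l x d) differentiable (at x)"
    and "\<And>t. t \<in> {1..T} \<Longrightarrow> \<eta> t > 0"
    and "\<And>t. t \<in> {1..T} \<Longrightarrow> M t > 0"
    and "prob_space P"
    and "prob_space.indep_vars P (\<lambda>_. borel) (\<lambda>(i, t). n i t) (UNIV \<times> {1..T})"
    and "\<And>i t. t \<in> {1..T} \<Longrightarrow> distributed P lborel (n i t) (\<lambda>x. ennreal (isotropic_normal_density (M t) x))"
    and "\<epsilon> > 0" "0 < \<delta>" "\<delta> < 1"
    and "(\<Sum>t=1..T. (sensitivity X W l \<eta> T t)\<^sup>2 / (M t)\<^sup>2) \<le> \<epsilon>\<^sup>2 / (\<epsilon> + 2 * ln (2 / \<delta>))"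
  shows "differentially_private neighbours (message_mechanism X W l \<eta> T P n) \<epsilon> \<delta>"
  unfolding differentially_private_def
proof (intro allI impI ballI)
  interpret P: prob_space P by fact
  fix D D' :: "('n, 'd) database" and S
  assume adj: "neighbours D D'" and S: "S \<in> sets (message_mechanism X W l \<eta> T P n D)"
  show "measure (message_mechanism X W l \<eta> T P n D) S \<le>
    exp \<epsilon> * measure (message_mechanism X W l \<eta> T P n D') S + \<delta>"
  \<comment> \<open>Without gradient rounds there is no noise, and the product characterisation of
    independence applied below needs a nonempty index set.\<close>
  proof (cases "T = 0")
    case True
    then have "messages X W l \<eta> T k D' = messages X W l \<eta> T k D" for k
      by (intro ext messages_shift) simp
    then have "message_mechanism X W l \<eta> T P n D' = message_mechanism X W l \<eta> T P n D"
      by (simp add: message_mechanism_def)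
    moreover have "1 * measure (message_mechanism X W l \<eta> T P n D) S \<le>
        exp \<epsilon> * measure (message_mechanism X W l \<eta> T P n D) S"
      using \<open>\<epsilon> > 0\<close> by (intro mult_right_mono) auto
    ultimately show ?thesis
      using \<open>0 < \<delta>\<close> by simp
  next
    case False
    define I where "I = (UNIV :: 'n set) \<times> {1..T}"
    define \<sigma> where "\<sigma> c = M (snd c)" for c :: "'n \<times> nat"
    define run where "run D x = messages X W l \<eta> T (\<lambda>i s. x (i, s)) D"
      for D :: "('n, 'd) database" and x :: "'n \<times> nat \<Rightarrow> real ^ 'p"
    \<comment> \<open>Both estimates are computed from the messages of the run on \<open>D\<close>:
      the same history, as in the conditional sensitivity.\<close>
    define v where "v c x = local_estimate X W l \<eta> T D (snd c) (run D x (snd c)) (fst c) -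
      local_estimate X W l \<eta> T D' (snd c) (run D x (snd c)) (fst c)" for c x
    let ?\<mu> = "\<lambda>A. \<Pi>\<^sub>M c\<in>A. (noise_measure (\<sigma> c) :: (real ^ 'p) measure)"
    obtain i0 where i0: "\<And>j. j \<noteq> i0 \<Longrightarrow> D j = D' j"
      using adj unfolding neighbours_def by metis
    \<comment> \<open>Only node \<open>i0\<close> is shifted, so the sum over all nodes and rounds
      collapses to the sum over rounds in the hypothesis.\<close>
    define b where "b c = (if fst c = i0 then sensitivity X W l \<eta> T (snd c) else 0)" for c
    have n_measurable: "n i t \<in> borel_measurable P" if "t \<in> {1..T}" for i t
      using distributed_measurable[OF assms(14)[OF that]] by simp
    have law: "noise_measure (\<sigma> (i, t)) = distr P borel (n i t)" if "t \<in> {1..T}" for i t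
      using distributed_distr_eq_density[OF assms(14)[OF that, of i]]
      by (simp add: noise_measure_def \<sigma>_def cong: distr_cong)
    have run_measurable: "(\<lambda>x. run D x t) \<in> borel_measurable (?\<mu> A)" for D t A
      unfolding run_def
      by (rule measurable_messages[OF assms(1-3,7-9)]) (auto intro!: borel_measurable_PiM_component)

    have prob: "prob_space (noise_measure (\<sigma> c) :: (real ^ 'p) measure)" if "c \<in> I" for c
      using that by (cases c) (auto simp: I_def law n_measurable intro!: P.prob_space_distr)
    have v_measurable: "v c \<in> borel_measurable (?\<mu> A)" for c A
    proof -
      have "(\<lambda>x. local_estimate X W l \<eta> T D'' (snd c) (run D x (snd c)) (fst c)) \<in> borel_measurable (?\<mu> A)"
        for D'' :: "('n, 'd) database"
        using measurable_compose[OF run_measurable[of D "snd c" A]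
            measurable_local_estimate[OF assms(1-3,7-9)]] .
      then show ?thesis
        unfolding v_def by (intro borel_measurable_diff)
    qed
    \<comment> \<open>Equality of rounds is allowed, since the messages of a round precede the noise
      drawn in it.\<close>
    have v_causal: "v c (x(c' := y)) = v c x" if "snd c \<le> snd c'" for c c' x y
    proof -
      have "run D (x(c' := y)) (snd c) = run D x (snd c)"
        unfolding run_def using that by (intro messages_cong) auto
      then show ?thesis by (simp add: v_def)
    qed
    interpret causal_shift I snd \<sigma> v
    proof (rule causal_shift.intro)
      show "finite I" by (simp add: I_def)
    qed (rule prob v_measurable v_causal; assumption)+

    interpret \<mu>: prob_space "noise I"
      by (rule prob_space_PiM) (rule prob)
    define \<Phi> where "\<Phi> D x = (\<lambda>t\<in>{1..}. run D x t)" for D x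
    have \<Phi>_measurable: "\<Phi> D \<in> noise I \<rightarrow>\<^sub>M (\<Pi>\<^sub>M t\<in>{1..}. borel)" for D
      unfolding \<Phi>_def using run_measurable by (intro measurable_restrict) auto
    \<comment> \<open>By independence the joint law of the noise is the product measure, so the
      mechanism is an image of the canonical space \<open>noise I\<close>.\<close>
    have mechanism: "message_mechanism X W l \<eta> T P n D = distr (noise I) (\<Pi>\<^sub>M t\<in>{1..}. borel) (\<Phi> D)" for D
    proof -
      define Z where "Z \<omega> = (\<lambda>c\<in>I. (case c of (i, t) \<Rightarrow> n i t) \<omega>)" for \<omega>
      have nonempty: "I \<noteq> {}"
        using False by (simp add: I_def)
      have "distr P (\<Pi>\<^sub>M c\<in>I. borel) Z = (\<Pi>\<^sub>M c\<in>I. distr P borel (case c of (i, t) \<Rightarrow> n i t))"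
        unfolding Z_def
      proof (rule P.indep_vars_iff_distr_eq_PiM'[THEN iffD1, OF nonempty])
        show "P.indep_vars (\<lambda>_. borel) (\<lambda>(i, t). n i t) I"
          using assms(13) by (simp add: I_def)
        show "P.random_variable borel (case c of (i, t) \<Rightarrow> n i t)" if "c \<in> I" for c
          using that n_measurable by (auto simp: I_def)
      qed
      also have "\<dots> = noise I"
        by (intro PiM_cong) (auto simp: I_def law)
      finally have *: "noise I = distr P (\<Pi>\<^sub>M c\<in>I. borel) Z" by simp
      have Z: "Z \<in> P \<rightarrow>\<^sub>M (\<Pi>\<^sub>M c\<in>I. borel)"
        unfolding Z_def using n_measurable by (intro measurable_restrict) (auto simp: I_def)
      have "\<Phi> D \<in> (\<Pi>\<^sub>M c\<in>I. borel) \<rightarrow>\<^sub>M (\<Pi>\<^sub>M t\<in>{1..}. borel)"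
        using \<Phi>_measurable[of D] by (simp add: * cong: measurable_cong_sets)
      then have "distr (noise I) (\<Pi>\<^sub>M t\<in>{1..}. borel) (\<Phi> D) =
          distr P (\<Pi>\<^sub>M t\<in>{1..}. borel) (\<lambda>\<omega>. \<Phi> D (Z \<omega>))"
        unfolding * using Z by (simp add: distr_distr comp_def)
      also have "(\<lambda>\<omega>. \<Phi> D (Z \<omega>)) = (\<lambda>\<omega>. \<lambda>t\<in>{1..}. messages X W l \<eta> T (\<lambda>i s. n i s \<omega>) D t)"
      proof
        fix \<omega>
        \<comment> \<open>\<open>Z\<close> is \<open>undefined\<close> outside \<open>I\<close>, but
          the messages read noise from rounds 1 to \<open>T\<close> only.\<close>
        have "run D (Z \<omega>) t = messages X W l \<eta> T (\<lambda>i s. n i s \<omega>) D t" for t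
          unfolding run_def by (rule messages_cong) (simp add: Z_def I_def)
        then show "\<Phi> D (Z \<omega>) = (\<lambda>t\<in>{1..}. messages X W l \<eta> T (\<lambda>i s. n i s \<omega>) D t)"
          by (simp add: \<Phi>_def)
      qed
      finally show ?thesis
        unfolding message_mechanism_def by (rule sym)
    qed
    have S': "S \<in> sets (\<Pi>\<^sub>M t\<in>{1..}. borel)"
      using S by (simp add: message_mechanism_def)
    define pre where "pre D = \<Phi> D -` S \<inter> space (noise I)" for D
    have pre: "pre D \<in> sets (noise I)" for D
      unfolding pre_def using \<Phi>_measurable S' by (rule measurable_sets)
    have measure_eq: "measure (message_mechanism X W l \<eta> T P n D) S = measure (noise I) (pre D)" for D
      unfolding mechanism pre_def by (rule measure_distr[OF \<Phi>_measurable S'])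

    have "emeasure (noise I) (pre D) \<le> ennreal (exp \<epsilon>) * emeasure (noise I) (pre D') + ennreal \<delta>"
    proof (rule emeasure_shift_le[where b = b])
      show "norm (v c x) \<le> b c" if "c \<in> I" for c x
      proof (cases "fst c = i0")
        case True
        have "snd c \<le> T"
          using that by (auto simp: I_def)
        then have "norm (v c x) \<le> sensitivity X W l \<eta> T (snd c)"
          unfolding v_def by (rule norm_local_estimate_diff_le_sensitivity[OF assms(1,2) _ adj])
        with True show ?thesis
          by (simp add: b_def)
      next
        case False
        then have "D (fst c) = D' (fst c)"
          by (rule i0)
        then have "v c x = 0"
          unfolding v_def by (subst local_estimate_cong) auto
        with False show ?thesis
          by (simp add: b_def)
      qed
      have "(\<Sum>c\<in>I. (b c)\<^sup>2 / (\<sigma> c)\<^sup>2) = (\<Sum>c\<in>{i0} \<times> {1..T}. (b c)\<^sup>2 / (\<sigma> c)\<^sup>2)"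
        by (rule sum.mono_neutral_right) (auto simp: I_def b_def)
      also have "\<dots> = (\<Sum>t=1..T. (sensitivity X W l \<eta> T t)\<^sup>2 / (M t)\<^sup>2)"
        by (simp add: sum.cartesian_product' b_def \<sigma>_def)
      finally show "(\<Sum>c\<in>I. (b c)\<^sup>2 / (\<sigma> c)\<^sup>2) \<le> \<epsilon>\<^sup>2 / (\<epsilon> + 2 * ln (2 / \<delta>))"
        using assms(18) by simp
      \<comment> \<open>The shifted noise makes \<open>D'\<close> produce the very messages that
        \<open>D\<close> produces from \<open>x\<close>.\<close>
      show "shift I x \<in> pre D'" if "x \<in> pre D" for x
      proof -
        have "run D' (shift I x) t = run D x t" for t
          unfolding run_def by (rule messages_shift) (simp add: shift_def I_def v_def run_def)
        then have "\<Phi> D' (shift I x) = \<Phi> D x"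
          by (simp add: \<Phi>_def)
        moreover have "shift I x \<in> space (noise I)"
          using that measurable_space[OF measurable_shift[OF order.refl], of x] by (simp add: pre_def)
        ultimately show ?thesis
          using that by (simp add: pre_def)
      qed
    qed (fact assms(15-17) pre)+
    then have "ennreal (measure (noise I) (pre D)) \<le> ennreal (exp \<epsilon> * measure (noise I) (pre D') + \<delta>)"
      using \<open>0 < \<delta>\<close> by (simp add: \<mu>.emeasure_eq_measure ennreal_mult)
    then show ?thesis
      unfolding measure_eq using \<open>0 < \<delta>\<close>
      by (subst (asm) ennreal_le_iff) (auto intro: add_nonneg_nonneg)
  qed
qed

end
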